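(* Let $n\ge 1$ and let $a_1,\dots,a_n$ be positive integers forming a symmetric sequence, i.e. $a_i=a_{n+1-i}$ for $1\le i\le n$. Define integers $P_i,Q_i$ ($-1\le i\le n$) by $P_{-1}=1$, $Q_{-1}=0$, $P_0=0$, $Q_0=1$ and, for $1\le i\le n$, $P_i=a_iP_{i-1}+P_{i-2}$, $Q_i=a_iQ_{i-1}+Q_{i-2}$ (so $P_i/Q_i$ is the $i$-th approximant of the continued fraction $0+\frac{1}{a_1+}\frac{1}{a_2+}\cdots\frac{1}{a_n}$). Then there exists a positive integer $a_0$ such that $\dfrac{2a_0P_n+P_{n-1}}{Q_n}$ is an integer if and only if $P_{n-1}Q_{n-1}$ is even. *)

theory Defs
  imports Complex_Main
begin

end

(*
  Reading the recurrence x_i = a_i x_{i-1} + x_{i-2} backwards along a symmetric sequence shows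
  that j \<mapsto> (-1)^j x_{n-1-j} satisfies the same recurrence, hence equals x_{n-1} Q_j - x_n P_j.
  At j = n, the choices x = Q and x = P give P_n = Q_{n-1} and P_n^2 - P_{n-1} Q_n = e with e = -(-1)^n.
  If P_{n-1} and P_n are both odd, then Q_n is even, so Q_n cannot divide the odd number
  2 a_0 P_n + P_{n-1}.  If P_{n-1} P_n is even, any a_0 with 2 a_0 = -e P_{n-1} P_n + 2 k Q_n works.
*)

theory Submission
  imports Defs
begin

text \<open>A solution of a second-order recurrence is fixed by two consecutive values, so both
  equations are proved together. The second at \<open>Suc m\<close> is the negated first at
  \<open>m\<close>. The coefficients \<open>x (n - 1)\<close> and \<open>- x n\<close> are the
  reversed sequence's values at indices 0 and -1, where \<open>(P, Q)\<close> is
  \<open>(0, 1)\<close> and \<open>(1, 0)\<close>.\<close>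

lemma symmetric_recurrence_reversal:
  fixes n :: int and a P Q x :: "int \<Rightarrow> int" and m :: nat
  assumes sym: "\<And>i. 1 \<le> i \<Longrightarrow> i \<le> n \<Longrightarrow> a i = a (n + 1 - i)"
    and init: "P (-1) = 1" "Q (-1) = 0" "P 0 = 0" "Q 0 = 1"
    and P: "\<And>i. 1 \<le> i \<Longrightarrow> i \<le> n \<Longrightarrow> P i = a i * P (i - 1) + P (i - 2)"
    and Q: "\<And>i. 1 \<le> i \<Longrightarrow> i \<le> n \<Longrightarrow> Q i = a i * Q (i - 1) + Q (i - 2)"
    and x: "\<And>i. 1 \<le> i \<Longrightarrow> i \<le> n \<Longrightarrow> x i = a i * x (i - 1) + x (i - 2)"
    and "int m \<le> n"
  shows "(-1) ^ m * x (n - 1 - int m) = x (n - 1) * Q (int m) - x n * P (int m)"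
    and "(-1) ^ m * x (n - int m) = x n * P (int m - 1) - x (n - 1) * Q (int m - 1)"
  using \<open>int m \<le> n\<close>
proof (induction m)
  case 0
  case 1 show ?case by (simp add: init)
  case 2 show ?case by (simp add: init)
next
  case (Suc m)
  {
    case 1
    let ?s = "(-1) ^ m :: int"
    have IH: "?s * x (n - 1 - int m) = x (n - 1) * Q (int m) - x n * P (int m)"
      "?s * x (n - int m) = x n * P (int m - 1) - x (n - 1) * Q (int m - 1)"
      using Suc.IH 1 by auto
    \<comment> \<open>The recurrence at \<open>n - m\<close> is solved for its lowest term; symmetry
      turns its coefficient into the one that carries \<open>P\<close> and \<open>Q\<close> from
      \<open>m\<close> to \<open>m + 1\<close>.\<close>
    have "x (n - int m) = a (n - int m) * x (n - int m - 1) + x (n - int m - 2)"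
      using x[of "n - int m"] 1 by simp
    moreover have "a (n - int m) = a (int m + 1)"
      using sym[of "int m + 1"] 1 by simp
    ultimately have step_back: "x (n - 2 - int m) = x (n - int m) - a (int m + 1) * x (n - 1 - int m)"
      by (simp add: algebra_simps)
    have "(-1) ^ Suc m * x (n - 2 - int m)
        = a (int m + 1) * (?s * x (n - 1 - int m)) - ?s * x (n - int m)"
      unfolding step_back by (simp add: algebra_simps)
    also have "\<dots> = x (n - 1) * (a (int m + 1) * Q (int m) + Q (int m - 1))
        - x n * (a (int m + 1) * P (int m) + P (int m - 1))"
      unfolding IH by (simp add: algebra_simps)
    also have "\<dots> = x (n - 1) * Q (int m + 1) - x n * P (int m + 1)"
      using P[of "int m + 1"] Q[of "int m + 1"] 1 by simp
    finally show ?case by (simp add: algebra_simps)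
  next
    case 2
    then show ?case using Suc.IH(1) by (simp add: algebra_simps)
  }
qed

lemma continuant_denominator_pos:
  fixes n :: int and a Q :: "int \<Rightarrow> int" and m :: nat
  assumes pos: "\<And>i. 1 \<le> i \<Longrightarrow> i \<le> n \<Longrightarrow> a i > 0"
    and init: "Q (-1) = 0" "Q 0 = 1"
    and Q: "\<And>i. 1 \<le> i \<Longrightarrow> i \<le> n \<Longrightarrow> Q i = a i * Q (i - 1) + Q (i - 2)"
    and "int m \<le> n"
  shows "Q (int m) > 0 \<and> Q (int m - 1) \<ge> 0"
  using \<open>int m \<le> n\<close>
proof (induction m)
  case (Suc m)
  then have "Q (int m + 1) = a (int m + 1) * Q (int m) + Q (int m - 1)" "a (int m + 1) > 0"
    using Q[of "int m + 1"] pos[of "int m + 1"] by simp_all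
  with Suc show ?case by (simp add: add.commute add_nonneg_pos)
qed (simp add: init)

text \<open>Modulo \<open>d\<close>, \<open>q\<^sup>2\<close> is \<open>e\<close> = 1 or -1, so
  \<open>e * q\<close> inverts \<open>q\<close> and the divisibility says that \<open>2 * b\<close>
  is congruent to \<open>- e * p * q\<close>.\<close>

lemma dvd_even_multiple_add_iff:
  fixes p q d e :: int
  assumes "d > 0" and det: "q\<^sup>2 - p * d = e" and e: "\<bar>e\<bar> = 1"
  shows "(\<exists>b>0. d dvd 2 * b * q + p) \<longleftrightarrow> even (p * q)"
proof
  assume "\<exists>b>0. d dvd 2 * b * q + p"
  then obtain b where b: "d dvd 2 * b * q + p" by blast
  show "even (p * q)"
  proof (rule ccontr)
    assume odd: "odd (p * q)"
    have "odd e" using e by (auto simp: abs_if split: if_splits)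
    \<comment> \<open>As \<open>q\<close> is odd, \<open>p * d\<close> must be even, and
      \<open>p\<close> is odd.\<close>
    then have "odd (q\<^sup>2 - p * d)" unfolding det .
    then have "even d" using odd by auto
    then have "even (2 * b * q + p)" using b by (rule dvd_trans)
    then show False using odd by simp
  qed
next
  assume "even (p * q)"
  then obtain c where c: "p * q = 2 * c" by blast
  \<comment> \<open>\<open>- e * c\<close> already solves the congruence; the added multiple of
    \<open>d\<close> does not disturb it and exceeds \<bar>c\<bar>, which makes \<open>b\<close>
    positive.\<close>
  define b where "b = - e * c + (\<bar>c\<bar> + 1) * d"
  have "(\<bar>c\<bar> + 1) * d \<ge> \<bar>c\<bar> + 1" using \<open>d > 0\<close> by simp
  moreover have "\<bar>e * c\<bar> = \<bar>c\<bar>" using e by (simp add: abs_mult)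
  ultimately have "b > 0" unfolding b_def by linarith
  have "e * e = 1" using e abs_mult_self_eq[of e] by simp
  have "2 * b * q + p = - e * (p * q) * q + p + 2 * (\<bar>c\<bar> + 1) * d * q"
    unfolding c b_def by (simp add: algebra_simps)
  \<comment> \<open>Here \<open>q * q\<close> becomes \<open>e + p * d\<close>, so that
    \<open>e * e = 1\<close> can cancel the lone \<open>p\<close>.\<close>
  also have "\<dots> = - e * p * (e + p * d) + p + 2 * (\<bar>c\<bar> + 1) * d * q"
    unfolding det[symmetric] by (simp add: algebra_simps power2_eq_square)
  also have "\<dots> = - (e * e) * p + p + d * (2 * (\<bar>c\<bar> + 1) * q - e * p * p)"
    by (simp add: algebra_simps)
  also have "\<dots> = d * (2 * (\<bar>c\<bar> + 1) * q - e * p * p)"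
    unfolding \<open>e * e = 1\<close> by simp
  finally have "d dvd 2 * b * q + p" by simp
  with \<open>b > 0\<close> show "\<exists>b>0. d dvd 2 * b * q + p" by blast
qed

theorem theorem1:
  fixes n :: int and a P Q :: "int \<Rightarrow> int"
  assumes "n \<ge> 1"
    and "\<And>i. 1 \<le> i \<Longrightarrow> i \<le> n \<Longrightarrow> a i > 0"
    and "\<And>i. 1 \<le> i \<Longrightarrow> i \<le> n \<Longrightarrow> a i = a (n + 1 - i)"
    and "P (-1) = 1" and "Q (-1) = 0" and "P 0 = 0" and "Q 0 = 1"
    and "\<And>i. 1 \<le> i \<Longrightarrow> i \<le> n \<Longrightarrow> P i = a i * P (i - 1) + P (i - 2)"
    and "\<And>i. 1 \<le> i \<Longrightarrow> i \<le> n \<Longrightarrow> Q i = a i * Q (i - 1) + Q (i - 2)"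
  shows "(\<exists>a0 :: int. a0 > 0 \<and>
            real_of_int (2 * a0 * P n + P (n - 1)) / real_of_int (Q n) \<in> \<int>)
         \<longleftrightarrow> even (P (n - 1) * Q (n - 1))"
proof -
  have n: "int (nat n) = n" using \<open>n \<ge> 1\<close> by simp
  have "Q n > 0"
    using continuant_denominator_pos[of n a Q "nat n", OF assms(2,5,7,9), unfolded n] by simp
  \<comment> \<open>At \<open>m = n\<close> the reversed index is -1, so the left side is an initial
    value: 0 for \<open>x = Q\<close> and, up to sign, 1 for \<open>x = P\<close>.\<close>
  have reversal: "(-1) ^ nat n * x (- 1) = x (n - 1) * Q n - x n * P n"
    if "\<And>i. 1 \<le> i \<Longrightarrow> i \<le> n \<Longrightarrow> x i = a i * x (i - 1) + x (i - 2)" for x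
  proof -
    have "(-1) ^ nat n * x (n - 1 - int (nat n))
        = x (n - 1) * Q (int (nat n)) - x n * P (int (nat n))"
      by (rule symmetric_recurrence_reversal(1)[of n a P Q x])
        (fact assms that | simp only: n order_refl)+
    then show ?thesis unfolding n by simp
  qed
  have "Q (n - 1) * Q n = P n * Q n"
    using reversal[of Q, OF assms(9)] assms(5) by simp
  then have "Q (n - 1) = P n" using \<open>Q n > 0\<close> by simp
  have "(P n)\<^sup>2 - P (n - 1) * Q n = - ((-1) ^ nat n)"
    using reversal[of P, OF assms(8)] assms(4) by (simp add: power2_eq_square)
  from dvd_even_multiple_add_iff[OF \<open>Q n > 0\<close> this]
  have "(\<exists>b>0. Q n dvd 2 * b * P n + P (n - 1)) \<longleftrightarrow> even (P (n - 1) * Q (n - 1))"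
    using \<open>Q (n - 1) = P n\<close> by simp
  moreover have "real_of_int k / real_of_int (Q n) \<in> \<int> \<longleftrightarrow> Q n dvd k" for k
    using \<open>Q n > 0\<close> of_int_div_of_int_in_Ints_iff[where 'a = real, of k "Q n"] by simp
  ultimately show ?thesis by (simp only:)
qed

end
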